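(* Let $X$ be a non-negative integer-valued random variable with probability function $p$, finite mean $\mu$, and let $q(x)=\delta x^2+\beta x+\gamma$ (real coefficients) be such that $\sum_{j=0}^x(\mu-j)p(j)=q(x)p(x)$ for all $x=0,1,2,\ldots$. Let $J=\{x\in\mathbb{Z}: p(x)>0\}$, let $k\ge 0$ be an integer, and for $x\in J$ let $$P_k(x)=\frac{(-1)^k}{p(x)}\Delta^k\bigl[q^{[k]}(x-k)p(x-k)\bigr]=\frac{1}{p(x)}\sum_{j=0}^k(-1)^{k-j}\binom{k}{j}q^{[k]}(x-j)p(x-j).$$ (i) Suppose $\mathbb{E}[X^{2k}]<\infty$ and $g:J\to\mathbb{R}$ satisfies $\mathbb{E}\bigl[q^{[k]}(X)\,|\Delta^k[g(X)]|\bigr]<\infty$. Then $\mathbb{E}|P_k(X)g(X)|<\infty$ and $$\mathbb{E}[P_k(X)g(X)]=\mathbb{E}\bigl[q^{[k]}(X)\Delta^k[g(X)]\bigr].$$ (ii) If $k\ge 1$ and $\mathbb{E}[X^{2k-1}]<\infty$, then $$q^{[k]}(x)p(x)=\frac{1}{(k-1)!}\sum_{y=x+1}^\infty (y-x-1)_{k-1}P_k(y)p(y),\qquad x=0,1,2,\ldots.$$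
   Context: $\Delta$ is the forward difference operator: $\Delta[g(x)]=g(x+1)-g(x)$, $\Delta^k=\Delta\circ\Delta^{k-1}$, $\Delta^0=\mathrm{id}$; $\Delta^k[F(x-k)]$ means the function $\Delta^kF$ evaluated at $x-k$. $q^{[k]}(x)=q(x)q(x+1)\cdots q(x+k-1)$, $q^{[0]}\equiv1$. $(x)_n=x(x-1)\cdots(x-n+1)$ for $n\ge1$ and $(x)_0=1$. $p(x)=0$ for $x<0$. The polynomial $q$ has degree at most 2 ($\delta,\beta$ may be zero). $J$ is automatically a finite or infinite integer interval. If $x\in J$ but $x+k\notin J$ then $q^{[k]}(x)=0$, and $q^{[k]}(x)\Delta^k[g(x)]$ is read as $0$; likewise $P_k(y)p(y)$ is read as $0$ when $y\notin J$. *)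

theory Defs
  imports "HOL-Probability.Probability"
begin

definition fdiff :: "(int \<Rightarrow> real) \<Rightarrow> int \<Rightarrow> real" where
  "fdiff g x = g (x + 1) - g x"

definition asc_prod :: "(int \<Rightarrow> real) \<Rightarrow> nat \<Rightarrow> int \<Rightarrow> real" where
  "asc_prod q k x = (\<Prod>i<k. q (x + int i))"

definition falling :: "int \<Rightarrow> nat \<Rightarrow> int" where
  "falling x n = (\<Prod>i<n. x - int i)"

(* Outside {x. p x > 0} the division makes this value 0; the values relevant
   to the mathematics are those at points with p x > 0. *)
definition rodrigues :: "(int \<Rightarrow> real) \<Rightarrow> (int \<Rightarrow> real) \<Rightarrow> nat \<Rightarrow> int \<Rightarrow> real" where
  "rodrigues q p k x =
     (-1) ^ k / p x * (fdiff ^^ k) (\<lambda>y. asc_prod q k y * p y) (x - int k)"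

lemma fdiff_power_shift:
  "(fdiff ^^ k) F (x - int k) = (\<Sum>j\<le>k. (-1) ^ j * real (k choose j) * F (x - int j))"
proof (induction k arbitrary: x)
  case 0
  show ?case by simp
next
  case (Suc k)
  have "(fdiff ^^ Suc k) F (x - int (Suc k))
      = (fdiff ^^ k) F (x - int k) - (fdiff ^^ k) F ((x - 1) - int k)"
    by (simp add: fdiff_def algebra_simps)
  also have "\<dots> = (\<Sum>j\<le>k. (-1) ^ j * real (k choose j) * F (x - int j))
      - (\<Sum>j\<le>k. (-1) ^ j * real (k choose j) * F (x - int (Suc j)))"
    by (simp only: Suc.IH) (simp add: algebra_simps)
  also have "(\<Sum>j\<le>k. (-1) ^ j * real (k choose j) * F (x - int j))
      = (\<Sum>j\<le>Suc k. (-1) ^ j * real (k choose j) * F (x - int j))"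
    by simp
  also have "\<dots> = F x + (\<Sum>j\<le>k. (-1) ^ Suc j * real (k choose Suc j) * F (x - int (Suc j)))"
    by (subst sum.atMost_Suc_shift) simp
  also have "F x + (\<Sum>j\<le>k. (-1) ^ Suc j * real (k choose Suc j) * F (x - int (Suc j)))
      - (\<Sum>j\<le>k. (-1) ^ j * real (k choose j) * F (x - int (Suc j)))
      = F x + (\<Sum>j\<le>k. (-1) ^ Suc j * real (Suc k choose Suc j) * F (x - int (Suc j)))"
    by (simp add: sum.distrib sum_negf sum_subtractf distrib_left distrib_right left_diff_distrib)
  also have "\<dots> = (\<Sum>j\<le>Suc k. (-1) ^ j * real (Suc k choose j) * F (x - int j))"
    by (subst sum.atMost_Suc_shift) simp
  finally show ?case .
qed

lemma rodrigues_eq_sum: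
  "rodrigues q p k x =
     1 / p x * (\<Sum>j=0..k. (-1) ^ (k - j) * real (k choose j) *
       (asc_prod q k (x - int j) * p (x - int j)))"
proof -
  have sign: "(-1) ^ k * (-1) ^ j = ((-1) ^ (k - j) :: real)" if "j \<le> k" for j
    using that by (auto simp: minus_one_power_iff)
  have "(-1) ^ k * (\<Sum>j\<le>k. (-1) ^ j * real (k choose j) * G j)
      = (\<Sum>j\<le>k. (-1) ^ (k - j) * real (k choose j) * G j)" for G :: "nat \<Rightarrow> real"
    unfolding sum_distrib_left
    by (rule sum.cong) (simp_all add: sign [symmetric] mult.assoc)
  then show ?thesis
    by (simp add: rodrigues_def fdiff_power_shift atLeast0AtMost)
qed

end

theory Submission
  imports Defs
begin

text \<open>
  Write \<open>T\<^sub>j(x) = (-1)\<^sup>j \<Delta>\<^sup>j[q\<^sup>[\<^sup>k\<^sup>] p](x - j)\<close>. The relation \<open>q(x) p(x) - q(x-1) p(x-1) = (\<mu> - x) p(x)\<close>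
  shows by induction that \<open>T\<^sub>j = q\<^sup>[\<^sup>k\<^sup>-\<^sup>j\<^sup>] L\<^sub>j p\<close> for a polynomial \<open>L\<^sub>j\<close> of degree at most \<open>j\<close> whose
  coefficient at \<open>x\<^sup>j\<close> is a product of factors \<open>1 - i \<delta>\<close> with \<open>i \<le> 2k - 2\<close>. The moment of order \<open>2k\<close>
  forces these factors to be positive when the support is unbounded, so \<open>T\<^sub>j \<ge> 0\<close> eventually.

  Both claims are \<open>k\<close>-fold summation by parts of \<open>\<Sum> T\<^sub>k g\<close>. For eventually nonnegative \<open>T\<^sub>j\<close>,
  absolute summability of \<open>T\<^sub>j \<Delta>h\<close> passes to \<open>T\<^sub>j\<^sub>+\<^sub>1 h\<close>. The boundary term converges and is
  bounded by \<open>n\<close> times a summable sequence, so it vanishes since the harmonic series diverges.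
  The inversion formula (ii) is the case \<open>g(y) = binomial(y - x - 1, k - 1)\<close> for \<open>y > x\<close> and
  \<open>g(y) = 0\<close> otherwise, whose \<open>k\<close>-th difference is the indicator of \<open>x\<close>.
\<close>

section \<open>Summation by parts for infinite series\<close>

text \<open>A nonzero limit would give \<open>1 = O(b)\<close>, hence \<open>1 / n = O(u)\<close>,
  and the harmonic series would converge by comparison.\<close>

lemma tendsto_zero_of_summable_div:
  fixes b u :: "nat \<Rightarrow> real"
  assumes "b \<longlonglongrightarrow> l" "summable (\<lambda>n. norm (u n))" "b \<in> O(\<lambda>n. real n * u n)"
  shows "l = 0"
proof (rule ccontr)
  assume "l \<noteq> 0"
  have "(\<lambda>n. b n / 1) \<longlonglongrightarrow> l" using assms(1) by simp
  from bigthetaI_tendsto[OF \<open>l \<noteq> 0\<close> this] have "(\<lambda>n. 1) \<in> O(b)"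
    by (simp add: bigtheta_def bigomega_iff_bigo)
  from landau_o.big_trans[OF this assms(3)]
  have "(\<lambda>n. inverse (real n) * 1) \<in> O(\<lambda>n. inverse (real n) * (real n * u n))"
    by (intro landau_o.big_mult) simp_all
  also have "(\<lambda>n. inverse (real n) * (real n * u n)) \<in> O(u)"
    by (intro bigoI[of _ 1] always_eventually allI) (simp add: abs_mult field_simps)
  finally have "summable (\<lambda>n. inverse (real n))"
    using summable_comparison_test_bigo[OF assms(2)] by simp
  then show False using not_summable_harmonic[where 'a = real] by simp
qed

lemma summation_by_parts:
  fixes t t' h :: "int \<Rightarrow> real" and N :: nat
  assumes "\<And>x. t' x = t (x - 1) - t x" "t (-1) = 0"
  shows "(\<Sum>n<N. t' (int n) * h (int n)) =
    (\<Sum>n<N. t (int n) * fdiff h (int n)) - t (int N - 1) * h (int N)"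
  by (induction N) (auto simp: assms fdiff_def algebra_simps)

text \<open>The boundary term is a difference of two convergent partial sums, so it has a limit,
  which \<open>tendsto_zero_of_summable_div\<close> forces to be 0. The sequence \<open>u\<close> is
  left free: it is the summand \<open>t' h\<close> itself in one use and a moment sequence in the
  other.\<close>

lemma suminf_by_parts:
  fixes t t' h :: "int \<Rightarrow> real"
  assumes t': "\<And>x. t' x = t (x - 1) - t x" "t (-1) = 0"
    and sum: "summable (\<lambda>n. \<bar>t (int n) * fdiff h (int n)\<bar>)"
    and sum': "summable (\<lambda>n. \<bar>t' (int n) * h (int n)\<bar>)"
    and u: "summable (\<lambda>n. norm (u n))" "(\<lambda>n. t (int n) * h (int n)) \<in> O(\<lambda>n. real n * u n)"
  shows "(\<Sum>n. t' (int n) * h (int n)) = (\<Sum>n. t (int n) * fdiff h (int n))"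
proof -
  \<comment> \<open>This is the boundary term \<open>t (n - 1) * h n\<close>, split so that each
    summand is of order n times a summable sequence.\<close>
  define b where "b n = t (int n) * h (int n) + t' (int n) * h (int n)" for n
  have b: "b n = t (int n - 1) * h (int n)" for n
    by (simp add: b_def t' algebra_simps)
  have s: "summable (\<lambda>n. t (int n) * fdiff h (int n))" "summable (\<lambda>n. t' (int n) * h (int n))"
    using sum sum' by (auto intro: summable_rabs_cancel)
  define l where "l = (\<Sum>n. t (int n) * fdiff h (int n)) - (\<Sum>n. t' (int n) * h (int n))"
  have "b = (\<lambda>N. (\<Sum>n<N. t (int n) * fdiff h (int n)) - (\<Sum>n<N. t' (int n) * h (int n)))"
    by (simp add: b fun_eq_iff summation_by_parts[OF t'])
  also have "\<dots> \<longlonglongrightarrow> l" unfolding l_def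
    by (intro tendsto_diff summable_LIMSEQ s)
  finally have lim: "b \<longlonglongrightarrow> l" .
  have "b \<in> O(\<lambda>n. real n * (norm (u n) + norm (t' (int n) * h (int n))))"
    unfolding b_def
  proof (rule sum_in_bigo)
    show "(\<lambda>n. t (int n) * h (int n)) \<in> O(\<lambda>n. real n * (norm (u n) + norm (t' (int n) * h (int n))))"
      by (rule landau_o.big_trans[OF u(2)])
        (auto intro!: bigoI[of _ 1] always_eventually mult_left_mono simp: abs_mult)
    show "(\<lambda>n. t' (int n) * h (int n)) \<in> O(\<lambda>n. real n * (norm (u n) + norm (t' (int n) * h (int n))))"
    proof (rule bigoI[of _ 1], use eventually_ge_at_top[of 1] in eventually_elim)
      case (elim n)
      have "norm (t' (int n) * h (int n)) \<le> 1 * (norm (u n) + norm (t' (int n) * h (int n)))" by simp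
      also have "\<dots> \<le> real n * (norm (u n) + norm (t' (int n) * h (int n)))"
        using elim by (intro mult_right_mono) auto
      finally show ?case by (simp add: abs_mult)
    qed
  qed
  then have "l = 0"
    using lim u(1) sum'
    by (intro tendsto_zero_of_summable_div[OF lim]) (auto intro: summable_add)
  then show ?thesis by (simp add: l_def)
qed

text \<open>Where both signs hold, \<open>|t' h| = t' |h|\<close> telescopes, and
  \<open>|h (x + 1)| \<le> |fdiff h x| + |h x|\<close> absorbs the change of
  \<open>h\<close>.\<close>

lemma summable_by_parts:
  fixes t t' h :: "int \<Rightarrow> real"
  assumes t': "\<And>x. t' x = t (x - 1) - t x"
    and pos: "eventually (\<lambda>n. t (int n) \<ge> 0) sequentially"
      "eventually (\<lambda>n. t' (int n) \<ge> 0) sequentially"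
    and sum: "summable (\<lambda>n. \<bar>t (int n) * fdiff h (int n)\<bar>)"
  shows "summable (\<lambda>n. \<bar>t' (int n) * h (int n)\<bar>)"
proof -
  obtain N where N: "t (int n) \<ge> 0" "t' (int n) \<ge> 0" if "n \<ge> N" for n
    using eventually_conj[OF pos] unfolding eventually_sequentially by blast
  define c where "c = t (int N) * \<bar>h (int N + 1)\<bar>"
  define f where "f n = \<bar>t (int (n + Suc N)) * fdiff h (int (n + Suc N))\<bar>" for n
  have sf: "summable f" unfolding f_def using sum by (rule summable_ignore_initial_segment)
  \<comment> \<open>The boundary term is kept on the right so that the induction closes, and is
    dropped by its sign only afterwards. The constant \<open>c\<close> cancels it at
    \<open>m = 0\<close>.\<close>
  have partial: "(\<Sum>n<m. \<bar>t' (int (n + Suc N)) * h (int (n + Suc N))\<bar>) \<le>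
      c + (\<Sum>n<m. f n) - t (int (m + N)) * \<bar>h (int (m + N) + 1)\<bar>" for m
  proof (induction m)
    case (Suc m)
    define x where "x = int (m + N)"
    have ix: "int (m + Suc N) = x + 1" "int (Suc m + N) = x + 1" by (simp_all add: x_def)
    have 1: "t (x + 1) \<ge> 0" "t' (x + 1) \<ge> 0"
      using N[of "m + Suc N"] by (simp_all add: ix[symmetric])
    have "\<bar>t' (x + 1) * h (x + 1)\<bar> = t x * \<bar>h (x + 1)\<bar> - t (x + 1) * \<bar>h (x + 1)\<bar>"
    proof -
      have "\<bar>t' (x + 1) * h (x + 1)\<bar> = t' (x + 1) * \<bar>h (x + 1)\<bar>" using 1 by (simp add: abs_mult)
      then show ?thesis by (simp add: t' left_diff_distrib)
    qed
    moreover have "t (x + 1) * \<bar>h (x + 1 + 1)\<bar> \<le> t (x + 1) * (\<bar>fdiff h (x + 1)\<bar> + \<bar>h (x + 1)\<bar>)"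
      using 1 by (intro mult_left_mono) (auto simp: fdiff_def)
    moreover have "f m = t (x + 1) * \<bar>fdiff h (x + 1)\<bar>"
      using 1 unfolding f_def ix by (simp add: abs_mult)
    ultimately show ?case using Suc.IH unfolding sum.lessThan_Suc ix x_def[symmetric]
      by (simp add: algebra_simps)
  qed (simp add: c_def)
  have "summable (\<lambda>n. \<bar>t' (int (n + Suc N)) * h (int (n + Suc N))\<bar>)"
  proof (rule summableI_nonneg_bounded)
    fix m
    have "t (int (m + N)) * \<bar>h (int (m + N) + 1)\<bar> \<ge> 0" using N[of "m + N"] by simp
    moreover have "(\<Sum>n<m. f n) \<le> suminf f"
      by (intro sum_le_suminf sf) (simp_all add: f_def)
    ultimately show "(\<Sum>n<m. \<bar>t' (int (n + Suc N)) * h (int (n + Suc N))\<bar>) \<le> c + suminf f"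
      using partial[of m] by linarith
  qed simp
  then show ?thesis using summable_iff_shift[of "\<lambda>n. \<bar>t' (int n) * h (int n)\<bar>" "Suc N"] by simp
qed

section \<open>Growth and sign of polynomials along the naturals\<close>

lemma poly_tendsto_coeff:
  fixes L :: "real poly"
  assumes "degree L \<le> d"
  shows "(\<lambda>n. poly L (real n) / real n ^ d) \<longlonglongrightarrow> coeff L d"
proof -
  have 1: "(\<lambda>n. coeff L i * (real n ^ i / real n ^ d)) \<longlonglongrightarrow> (if i = d then coeff L d else 0)"
    if "i \<le> d" for i
  proof (cases "i = d")
    case True
    have "eventually (\<lambda>n. coeff L i * (real n ^ i / real n ^ d) = coeff L d) sequentially"
      using eventually_gt_at_top[of "0::nat"] by eventually_elim (simp add: True)
    then show ?thesis using True by (simp add: tendsto_eventually)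
  next
    case False
    then have "i < d" using that by simp
    then obtain e where e: "d = i + Suc e" by (metis less_imp_Suc_add add_Suc_right)
    have "(\<lambda>n. inverse (real n) ^ Suc e) \<longlonglongrightarrow> 0 ^ Suc e"
      by (intro tendsto_power) (rule lim_inverse_n)
    then have "(\<lambda>n. coeff L i * inverse (real n) ^ Suc e) \<longlonglongrightarrow> coeff L i * 0"
      by (intro tendsto_mult) auto
    moreover have "eventually (\<lambda>n. coeff L i * inverse (real n) ^ Suc e =
        coeff L i * (real n ^ i / real n ^ d)) sequentially"
      using eventually_gt_at_top[of "0::nat"] by eventually_elim (simp add: e power_add field_simps)
    ultimately show ?thesis using False by (auto elim: Lim_transform_eventually)
  qed
  have "(\<lambda>n. \<Sum>i\<le>d. coeff L i * (real n ^ i / real n ^ d)) \<longlonglongrightarrow> (\<Sum>i\<le>d. if i = d then coeff L d else 0)"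
    by (intro tendsto_sum 1) auto
  moreover have "(\<Sum>i\<le>d. coeff L i * (x ^ i / x ^ d)) = poly L x / x ^ d" for x
    using assms by (simp add: poly_altdef sum_divide_distrib)
      (intro sum.mono_neutral_right, auto simp: coeff_eq_0)
  ultimately show ?thesis by simp
qed

lemma poly_bigo:
  fixes L :: "real poly"
  assumes "degree L \<le> d"
  shows "(\<lambda>n. poly L (real n)) \<in> O(\<lambda>n. real n ^ d)"
  using poly_tendsto_coeff[OF assms] eventually_gt_at_top[of "0::nat"]
  by (intro bigoI_tendsto[of _ _ "coeff L d"]) (auto elim: eventually_mono)

lemma poly_bigomega:
  fixes L :: "real poly"
  assumes "degree L \<le> d" "coeff L d > 0"
  shows "(\<lambda>n. real n ^ d) \<in> O(\<lambda>n. poly L (real n))"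
proof -
  have "(\<lambda>n. poly L (real n)) \<in> \<Theta>(\<lambda>n. real n ^ d)"
    using assms(2) poly_tendsto_coeff[OF assms(1)] eventually_gt_at_top[of "0::nat"]
    by (intro bigthetaI_tendsto[of "coeff L d"]) (auto elim: eventually_mono)
  then show ?thesis by (simp add: bigtheta_def bigomega_iff_bigo)
qed

lemma poly_eventually_pos:
  fixes L :: "real poly"
  assumes "degree L \<le> d" "coeff L d > 0"
  shows "eventually (\<lambda>n. poly L (real n) > 0) sequentially"
  using order_tendstoD(1)[OF poly_tendsto_coeff[OF assms(1)] assms(2)]
  by eventually_elim (auto simp: zero_less_divide_iff not_less[symmetric])

text \<open>For L = a + x K, with D the difference K(x - 1) - K, the difference for L is x D - K -
  D, which gives the induction. At \<open>d = 0\<close> the truncated \<open>d - 1\<close> makes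
  both claims say that coefficient 0 vanishes.\<close>

lemma coeff_backward_shift:
  fixes L :: "real poly"
  assumes "degree L \<le> d"
  shows "(\<forall>i\<ge>d. coeff (pcompose L [:-1, 1:] - L) i = 0) \<and>
    coeff (pcompose L [:-1, 1:] - L) (d - 1) = - real d * coeff L d"
  using assms
proof (induction d arbitrary: L)
  case 0
  then obtain a where "L = [:a:]" by (metis le_zero_eq degree_eq_zeroE)
  then show ?case by simp
next
  case (Suc d)
  obtain a K where L: "L = pCons a K" by (cases L)
  have K: "degree K \<le> d" using Suc.prems by (cases "K = 0") (simp_all add: L)
  define D where "D = pcompose K [:-1, 1:] - K"
  have D: "\<forall>i\<ge>d. coeff D i = 0" "coeff D (d - 1) = - real d * coeff K d"
    using Suc.IH[OF K] by (simp_all add: D_def)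
  have "pcompose K [:-1, 1:] = K + D" by (simp add: D_def)
  then have eq: "pcompose L [:-1, 1:] - L = pCons 0 D - K - D"
    by (simp add: L pcompose_pCons algebra_simps)
  have K0: "coeff K i = 0" if "i > d" for i using K that by (intro coeff_eq_0) simp
  have "coeff (pcompose L [:-1, 1:] - L) i = 0" if "i \<ge> Suc d" for i
    using D(1) K0[of i] that unfolding eq by (cases i) simp_all
  moreover have "coeff (pcompose L [:-1, 1:] - L) d = - real (Suc d) * coeff L (Suc d)"
    using D unfolding eq by (cases d) (simp_all add: L algebra_simps)
  ultimately show ?case by simp
qed

section \<open>Expectations of a natural-valued variable as series\<close>

lemma distr_density_nat:
  fixes X :: "'a \<Rightarrow> nat"
  assumes "finite_measure M" "X \<in> measurable M (count_space UNIV)"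
  shows "distr M (count_space UNIV) X =
    density (count_space UNIV) (\<lambda>n. ennreal (measure M {\<omega> \<in> space M. X \<omega> = n}))"
proof (rule measure_eqI_countable[of _ UNIV])
  interpret finite_measure M by fact
  fix a :: nat
  have [simp]: "X -` {a} \<inter> space M = {\<omega> \<in> space M. X \<omega> = a}" by auto
  show "emeasure (distr M (count_space UNIV) X) {a} = emeasure (density (count_space UNIV)
      (\<lambda>n. ennreal (measure M {\<omega> \<in> space M. X \<omega> = n}))) {a}"
    using assms(2) by (simp add: emeasure_distr emeasure_density emeasure_eq_measure)
qed auto

lemma integrable_nat_valued_iff:
  fixes X :: "'a \<Rightarrow> nat" and f :: "nat \<Rightarrow> real"
  assumes "finite_measure M" "X \<in> measurable M (count_space UNIV)"
  shows "integrable M (\<lambda>\<omega>. f (X \<omega>)) \<longleftrightarrow>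
    summable (\<lambda>n. \<bar>f n * measure M {\<omega> \<in> space M. X \<omega> = n}\<bar>)"
proof -
  have "integrable M (\<lambda>\<omega>. f (X \<omega>)) \<longleftrightarrow> integrable (distr M (count_space UNIV) X) f"
    using assms(2) by (subst integrable_distr_eq) auto
  also have "\<dots> \<longleftrightarrow> summable (\<lambda>n. \<bar>f n * measure M {\<omega> \<in> space M. X \<omega> = n}\<bar>)"
    unfolding distr_density_nat[OF assms]
    by (subst integrable_density) (auto simp: integrable_count_space_nat_iff mult.commute)
  finally show ?thesis .
qed

lemma integral_nat_valued:
  fixes X :: "'a \<Rightarrow> nat" and f :: "nat \<Rightarrow> real"
  assumes "finite_measure M" "X \<in> measurable M (count_space UNIV)"
    and "integrable M (\<lambda>\<omega>. f (X \<omega>))"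
  shows "(\<integral>\<omega>. f (X \<omega>) \<partial>M) = (\<Sum>n. f n * measure M {\<omega> \<in> space M. X \<omega> = n})"
proof -
  have "(\<integral>\<omega>. f (X \<omega>) \<partial>M) = integral\<^sup>L (distr M (count_space UNIV) X) f"
    using assms(2) by (subst integral_distr) auto
  also have "\<dots> = (\<integral>n. measure M {\<omega> \<in> space M. X \<omega> = n} *\<^sub>R f n \<partial>count_space UNIV)"
    unfolding distr_density_nat[OF assms(1,2)] by (subst integral_density) auto
  also have "\<dots> = (\<Sum>n. f n * measure M {\<omega> \<in> space M. X \<omega> = n})"
    using assms(3) unfolding integrable_nat_valued_iff[OF assms(1,2)]
    by (subst integral_count_space_nat) (auto simp: integrable_count_space_nat_iff mult.commute)
  finally show ?thesis .
qed

section \<open>The difference relation and the support of p\<close>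

text \<open>The deterministic facts about the law: \<open>rec\<close> is the difference of the
  integrated relation at \<open>x\<close> and \<open>x - 1\<close>, extended to all integers, and
  \<open>qp_nonneg\<close> is what remains of \<mu> being the mean.\<close>

locale integrated_pearson =
  fixes p q :: "int \<Rightarrow> real" and \<mu> \<delta> \<beta> \<gamma> :: real
  assumes p_nonneg: "p x \<ge> 0"
    and p_neg: "x < 0 \<Longrightarrow> p x = 0"
    and q_eq: "q x = \<delta> * (real_of_int x)\<^sup>2 + \<beta> * real_of_int x + \<gamma>"
    and rec: "q x * p x - q (x - 1) * p (x - 1) = (\<mu> - real_of_int x) * p x"
    and qp_nonneg: "q x * p x \<ge> 0"
begin

text \<open>At the first zero of p to the right of x, \<open>rec\<close> forces q p to vanish one
  point earlier, where p is still positive.\<close>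

lemma exists_zero_of_support_end:
  assumes "p x > 0" "p (x + int i) = 0"
  shows "\<exists>j<i. q (x + int j) = 0"
  using assms(2)
proof (induction i)
  case (Suc i)
  show ?case
  proof (cases "p (x + int i) = 0")
    case True
    then show ?thesis using Suc.IH less_SucI by blast
  next
    case False
    then have "q (x + int i) = 0"
      using rec[of "x + int (Suc i)"] Suc.prems by (simp add: add.assoc[symmetric])
    then show ?thesis by blast
  qed
qed (use assms(1) in simp)

lemma asc_prod_eq_0:
  assumes "p x > 0" "p (x + int i) = 0" "i \<le> r"
  shows "asc_prod q r x = 0"
  unfolding asc_prod_def
  using exists_zero_of_support_end[OF assms(1,2)] assms(3)
  by (auto intro!: prod_zero)

text \<open>Single values of q may be negative off the support. But if p x > 0 and the run from x to
  x + r - 1 leaves the support, the whole product vanishes; otherwise every factor is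
  nonnegative.\<close>

lemma asc_prod_p_nonneg: "asc_prod q r x * p x \<ge> 0"
proof (cases "\<exists>i<r. p (x + int i) = 0")
  case True
  then show ?thesis
    using asc_prod_eq_0[of x _ r] p_nonneg[of x] by (cases "p x = 0") force+
next
  case False
  have "q (x + int i) \<ge> 0" if "i < r" for i
    using False that qp_nonneg[of "x + int i"] p_nonneg[of "x + int i"]
    by (auto simp: zero_le_mult_iff order_less_le)
  then show ?thesis by (auto simp: asc_prod_def p_nonneg intro!: prod_nonneg mult_nonneg_nonneg)
qed

text \<open>Past the mean, \<open>rec\<close> equates the nonnegative next value of q p with a
  negative multiple of the next value of p, so both are 0 and the zeros propagate.\<close>

lemma p_eq_0_beyond:
  assumes "q x * p x = 0" "\<mu> \<le> real_of_int x" "x < y"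
  shows "p y = 0"
proof -
  have "p (z + 1) = 0 \<and> q (z + 1) * p (z + 1) = 0" if "x \<le> z" for z
    using that
  proof (induction z rule: int_ge_induct)
    case base
    have "(\<mu> - real_of_int (x + 1)) * p (x + 1) \<ge> 0"
      using rec[of "x + 1"] qp_nonneg[of "x + 1"] assms(1) unfolding add_diff_cancel_right' by linarith
    then show ?case using assms(2) p_nonneg[of "x + 1"] by (auto simp: zero_le_mult_iff)
  next
    case (step z)
    have "(\<mu> - (real_of_int z + 2)) * p (z + 2) \<ge> 0"
      using rec[of "z + 2"] qp_nonneg[of "z + 2"] step.IH by (simp add: algebra_simps)
    then show ?case using assms(2) step.hyps p_nonneg[of "z + 2"]
      by (auto simp: zero_le_mult_iff add.commute[of 2 z])
  qed
  from this[of "y - 1"] show ?thesis using assms(3) by simp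
qed

section \<open>Rodrigues differences as polynomial multiples of p\<close>

text \<open>The first quadratic is q(x) - \<mu> + x, which by \<open>rec\<close> converts q(x - 1)
  p(x - 1) into a multiple of p(x); the second is q(x + r).\<close>

definition lower :: "nat \<Rightarrow> real poly \<Rightarrow> real poly" where
  "lower r L = pcompose L [:-1, 1:] * [:\<gamma> - \<mu>, \<beta> + 1, \<delta>:] -
     L * pcompose [:\<gamma>, \<beta>, \<delta>:] [:real r, 1:]"

text \<open>Splitting q(x - 1) off the front of one product and q(x + r) off the back of the other
  leaves the common factor \<open>asc_prod q r x\<close>.\<close>

lemma poly_lower:
  "asc_prod q r x * poly (lower r L) (real_of_int x) * p x =
    asc_prod q (Suc r) (x - 1) * poly L (real_of_int (x - 1)) * p (x - 1) -
    asc_prod q (Suc r) x * poly L (real_of_int x) * p x"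
proof -
  have 1: "asc_prod q (Suc r) (x - 1) = q (x - 1) * asc_prod q r x"
    unfolding asc_prod_def by (subst prod.lessThan_Suc_shift) (simp add: algebra_simps)
  have 2: "asc_prod q (Suc r) x = asc_prod q r x * q (x + int r)"
    by (simp add: asc_prod_def)
  have 3: "q (x - 1) * p (x - 1) = (q x - \<mu> + real_of_int x) * p x"
    using rec[of x] by (simp add: algebra_simps)
  have 4: "poly (lower r L) (real_of_int x) =
      poly L (real_of_int (x - 1)) * (q x - \<mu> + real_of_int x) - poly L (real_of_int x) * q (x + int r)"
    by (simp add: lower_def poly_pcompose q_eq power2_eq_square algebra_simps)
  have "asc_prod q (Suc r) (x - 1) * poly L (real_of_int (x - 1)) * p (x - 1) =
      asc_prod q r x * poly L (real_of_int (x - 1)) * (q (x - 1) * p (x - 1))"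
    by (simp add: 1)
  then show ?thesis unfolding 2 3 4 by (simp add: algebra_simps)
qed

text \<open>With L(x - 1) = L + D, the factor of L is q(x) - \<mu> + x - q(x + r), whose quadratic
  terms cancel and whose slope is 1 - 2 r \<delta>. D drops one degree, so only its product with
  \<delta> x^2 reaches x^(d + 1), contributing - d \<delta>.\<close>

lemma degree_lower:
  assumes "degree L \<le> d"
  shows "degree (lower r L) \<le> Suc d"
    and "coeff (lower r L) (Suc d) = (1 - real (2 * r + d) * \<delta>) * coeff L d"
proof -
  define D where "D = pcompose L [:-1, 1:] - L"
  have D: "\<And>i. i \<ge> d \<Longrightarrow> coeff D i = 0" "coeff D (d - 1) = - real d * coeff L d"
    using coeff_backward_shift[OF assms] by (simp_all add: D_def)
  have L: "coeff L i = 0" if "i > d" for i using assms that by (intro coeff_eq_0) simp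
  have "pcompose L [:-1, 1:] = L + D" by (simp add: D_def)
  then have "lower r L = L * ([:\<gamma> - \<mu>, \<beta> + 1, \<delta>:] - pcompose [:\<gamma>, \<beta>, \<delta>:] [:real r, 1:]) +
      D * [:\<gamma> - \<mu>, \<beta> + 1, \<delta>:]"
    by (simp only: lower_def algebra_simps)
  also have "[:\<gamma> - \<mu>, \<beta> + 1, \<delta>:] - pcompose [:\<gamma>, \<beta>, \<delta>:] [:real r, 1:] =
      [:- \<mu> - \<beta> * real r - \<delta> * (real r)\<^sup>2, 1 - 2 * real r * \<delta>:]"
    by (simp add: pcompose_pCons power2_eq_square algebra_simps)
  finally have eq: "lower r L =
      L * [:- \<mu> - \<beta> * real r - \<delta> * (real r)\<^sup>2, 1 - 2 * real r * \<delta>:] + D * [:\<gamma> - \<mu>, \<beta> + 1, \<delta>:]" .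
  have "coeff (lower r L) i = 0" if i: "i > Suc d" for i
  proof -
    obtain j where "i = Suc (Suc j)" "j \<ge> d" using i by (metis Suc_le_D Suc_le_eq Suc_le_mono less_imp_le_nat)
    then show ?thesis by (simp add: eq D L)
  qed
  then show "degree (lower r L) \<le> Suc d" by (intro degree_le) simp
  show "coeff (lower r L) (Suc d) = (1 - real (2 * r + d) * \<delta>) * coeff L d"
  proof (cases d)
    case (Suc e)
    have De: "coeff D e = - real (Suc e) * coeff L (Suc e)" using D(2) by (simp only: Suc diff_Suc_1)
    show ?thesis by (simp add: eq D(1) L Suc De algebra_simps)
  qed (simp add: eq D(1) L algebra_simps)
qed

primrec rod_poly :: "nat \<Rightarrow> nat \<Rightarrow> real poly" where
  "rod_poly k 0 = 1"
| "rod_poly k (Suc j) = lower (k - Suc j) (rod_poly k j)"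

lemma degree_rod_poly: "degree (rod_poly k j) \<le> j"
  by (induction j) (auto intro: degree_lower)

text \<open>The step from j to j + 1 multiplies by 1 - (2k - 2 - j) \<delta>. For \<delta> > 0 this
  is smallest at j = 0, where the hypothesis makes it positive; for \<delta> \<le> 0 it is at least
  1.\<close>

lemma coeff_rod_poly_pos:
  assumes "(2 * real k - 2) * \<delta> < 1" "j \<le> k"
  shows "coeff (rod_poly k j) j > 0"
  using assms(2)
proof (induction j)
  case (Suc j)
  have r: "real (2 * (k - Suc j) + j) = 2 * real k - 2 - real j"
    using Suc.prems by (simp add: of_nat_diff)
  have "real (2 * (k - Suc j) + j) * \<delta> < 1"
  proof (cases "\<delta> \<le> 0")
    case True
    then have "real (2 * (k - Suc j) + j) * \<delta> \<le> 0" by (intro mult_nonneg_nonpos) auto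
    then show ?thesis by simp
  next
    case False
    then have "real (2 * (k - Suc j) + j) * \<delta> \<le> (2 * real k - 2) * \<delta>"
      unfolding r by (intro mult_right_mono) auto
    then show ?thesis using assms(1) by simp
  qed
  then show ?case using Suc degree_lower(2)[OF degree_rod_poly, of "k - Suc j" k j] by simp
qed simp

text \<open>\<open>rod_diff k j\<close> is \<open>T\<^sub>j\<close>, and \<open>rod_poly k j\<close> is its factor \<open>L\<^sub>j\<close>.\<close>

definition rod_diff :: "nat \<Rightarrow> nat \<Rightarrow> int \<Rightarrow> real" where
  "rod_diff k j x = asc_prod q (k - j) x * poly (rod_poly k j) (real_of_int x) * p x"

lemma rod_diff_0: "rod_diff k 0 x = asc_prod q k x * p x"
  by (simp add: rod_diff_def)

lemma rod_diff_neg: "x < 0 \<Longrightarrow> rod_diff k j x = 0"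
  by (simp add: rod_diff_def p_neg)

lemma rod_diff_Suc:
  assumes "j < k"
  shows "rod_diff k (Suc j) x = rod_diff k j (x - 1) - rod_diff k j x"
  using poly_lower[of "k - Suc j" x "rod_poly k j"] assms
  by (simp add: rod_diff_def Suc_diff_Suc)

lemma rod_diff_eq_fdiff:
  assumes "j \<le> k"
  shows "rod_diff k j x = (-1) ^ j * (fdiff ^^ j) (\<lambda>y. asc_prod q k y * p y) (x - int j)"
  using assms
proof (induction j arbitrary: x)
  case (Suc j)
  then show ?case
    by (simp add: rod_diff_Suc fdiff_def algebra_simps)
qed (simp add: rod_diff_0)

text \<open>Off the support both sides are 0, so the convention for P_k p there agrees with the
  actual k-th difference, which contains the factor \<open>p x\<close>.\<close>

lemma rodrigues_mult_p: "rodrigues q p k x * p x = rod_diff k k x"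
proof (cases "p x = 0")
  case True
  then show ?thesis by (simp add: rod_diff_def)
next
  case False
  then show ?thesis by (simp add: rodrigues_def rod_diff_eq_fdiff)
qed

section \<open>Growth and eventual sign of the differences\<close>

lemma q_bigo: "(\<lambda>n. q (int n + int i)) \<in> O(\<lambda>n. real n ^ 2)"
proof -
  have "(\<lambda>n. q (int n + int i)) = (\<lambda>n. poly (pcompose [:\<gamma>, \<beta>, \<delta>:] [:real i, 1:]) (real n))"
    by (simp add: q_eq poly_pcompose power2_eq_square algebra_simps)
  also have "\<dots> \<in> O(\<lambda>n. real n ^ 2)"
    by (intro poly_bigo order_trans[OF degree_pcompose_le]) simp
  finally show ?thesis .
qed

lemma asc_prod_bigo: "(\<lambda>n. asc_prod q r (int n)) \<in> O(\<lambda>n. real n ^ (2 * r))"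
proof (induction r)
  case (Suc r)
  from landau_o.big_mult[OF this q_bigo[of r]] show ?case
    by (simp add: asc_prod_def power_add[symmetric] del: power_add)
qed (simp add: asc_prod_def)

text \<open>Each difference trades a factor q, of order n^2, for one degree in
  \<open>rod_poly\<close>, so one power of n is gained per step.\<close>

lemma rod_diff_bigo:
  assumes "j \<le> k"
  shows "(\<lambda>n. rod_diff k j (int n)) \<in> O(\<lambda>n. real n ^ (2 * k - j) * p (int n))"
proof -
  have "(\<lambda>n. asc_prod q (k - j) (int n) * poly (rod_poly k j) (real n) * p (int n)) \<in>
      O(\<lambda>n. real n ^ (2 * (k - j)) * real n ^ j * p (int n))"
    by (intro landau_o.big_mult asc_prod_bigo poly_bigo degree_rod_poly landau_o.big_refl)
  moreover have "2 * (k - j) + j = 2 * k - j" using assms by simp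
  ultimately show ?thesis by (simp add: rod_diff_def power_add[symmetric])
qed

text \<open>Otherwise \<open>x\<^sup>m q(x) p(x)\<close> with \<open>m = 2k - 1\<close> is eventually nondecreasing, contradicting the moment
  of order \<open>2k\<close>.\<close>

lemma delta_bound:
  assumes k: "k \<ge> 1" and sum: "summable (\<lambda>n. real n ^ (2 * k) * p (int n))"
    and inf: "\<not> eventually (\<lambda>n. p (int n) = 0) sequentially"
  shows "(2 * real k - 2) * \<delta> < 1"
proof (rule ccontr)
  assume contra: "\<not> ?thesis"
  \<comment> \<open>This exponent makes the leading coefficient 1 - m \<delta> of
    \<open>lower 0 L\<close> negative and keeps V at order n times the summable n^(2k) p.\<close>
  define m where "m = 2 * k - 1"
  have m: "real m = 2 * real k - 1" using k by (simp add: m_def of_nat_diff)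
  have "\<delta> > 0" using contra k
    by (metis mult_nonneg_nonpos of_nat_mono of_nat_1 diff_ge_0_iff_ge linorder_not_less
        mult_left_mono mult.right_neutral order_le_less_trans zero_less_one one_add_one distrib_left
        of_nat_0_le_iff zero_le_numeral)
  then have m1: "real m * \<delta> > 1" using contra by (simp add: m algebra_simps)
  define L where "L = (monom 1 m :: real poly)"
  define V where "V x = asc_prod q (Suc 0) x * poly L (real_of_int x) * p x" for x
  have dL: "degree L \<le> m" by (simp add: L_def degree_monom_le)
  have "eventually (\<lambda>n. poly (- lower 0 L) (real n) > 0) sequentially"
    using degree_lower[OF dL, of 0] m1
    by (intro poly_eventually_pos[of _ "Suc m"]) (simp_all add: L_def)
  then obtain N1 where N1: "poly (lower 0 L) (real n) < 0" if "n \<ge> N1" for n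
    unfolding eventually_sequentially by auto
  have step: "V (x - 1) \<le> V x" if "x \<ge> int N1" for x
  proof -
    have "V (x - 1) - V x = poly (lower 0 L) (real_of_int x) * p x"
      using poly_lower[of 0 x L] by (simp add: V_def asc_prod_def)
    also have "\<dots> \<le> 0"
      using N1[of "nat x"] that p_nonneg[of x] by (intro mult_nonpos_nonneg) (auto simp: less_imp_le)
    finally show ?thesis by simp
  qed
  \<comment> \<open>Beyond 1 the power is positive, beyond \<open>N1\<close> V is monotone, and
    beyond \<mu> a zero of q p would end the support.\<close>
  define N where "N = Max {1, N1, nat \<lceil>\<mu>\<rceil>}"
  have N: "N \<ge> 1" "N \<ge> N1" "\<mu> \<le> real N"
    unfolding N_def by (auto intro: order_trans[OF real_nat_ceiling_ge] simp: le_max_iff_disj)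
  have mono: "V (int N) \<le> V (int n)" if "n \<ge> N" for n
    using that
  proof (induction n rule: dec_induct)
    case (step n)
    then show ?case using \<open>\<And>x. x \<ge> int N1 \<Longrightarrow> V (x - 1) \<le> V x\<close>[of "int (Suc n)"] N by simp
  qed simp
  have "q (int N) * p (int N) \<noteq> 0"
  proof
    assume "q (int N) * p (int N) = 0"
    then have "eventually (\<lambda>n. p (int n) = 0) sequentially"
      using N(3) by (intro eventually_mono[OF eventually_gt_at_top[of N]] p_eq_0_beyond[of "int N"]) auto
    with inf show False by simp
  qed
  then have "q (int N) * p (int N) > 0" using qp_nonneg[of "int N"] by linarith
  then have "real N ^ m * (q (int N) * p (int N)) > 0"
    by (rule mult_pos_pos[rotated]) (use N(1) in simp)
  then have pos: "V (int N) > 0"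
    by (simp add: V_def L_def poly_monom asc_prod_def mult_ac)
  \<comment> \<open>A positive constant would thus be O of n times a summable sequence, which
    \<open>tendsto_zero_of_summable_div\<close> excludes.\<close>
  have "(\<lambda>n. V (int N)) \<in> O(\<lambda>n. V (int n))"
    using mono pos by (intro bigoI[of _ 1] eventually_mono[OF eventually_ge_at_top[of N]]) force
  also have "(\<lambda>n. V (int n)) \<in> O(\<lambda>n. real n * (real n ^ (2 * k) * p (int n)))"
  proof -
    have "(\<lambda>n. asc_prod q (Suc 0) (int n) * poly L (real n) * p (int n)) \<in>
        O(\<lambda>n. real n ^ (2 * Suc 0) * real n ^ m * p (int n))"
      by (intro landau_o.big_mult asc_prod_bigo poly_bigo dL landau_o.big_refl)
    moreover have "2 * Suc 0 + m = Suc (2 * k)" using k by (simp add: m_def)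
    then have "real n ^ (2 * Suc 0) * real n ^ m = real n * real n ^ (2 * k)" for n
      by (simp only: power_add[symmetric] power_Suc[symmetric])
    ultimately show ?thesis by (simp only: V_def of_int_of_nat_eq mult.assoc[symmetric])
  qed
  finally have "V (int N) = 0"
    using sum p_nonneg by (intro tendsto_zero_of_summable_div[OF tendsto_const]) auto
  with pos show False by simp
qed

text \<open>\<open>delta_bound\<close> makes the leading coefficients positive. Consecutive
  differences share the factor \<open>asc_prod q (k - Suc j) * p\<close>; what remains is q(x + r)
  L_j, of order at most n^(j + 2), against n L_(j+1), of exactly that order.\<close>

lemma rod_diff_eventually:
  assumes sum: "summable (\<lambda>n. real n ^ (2 * k) * p (int n))" and j: "j \<le> k"
  shows "eventually (\<lambda>n. rod_diff k j (int n) \<ge> 0) sequentially"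
    and "j < k \<Longrightarrow> (\<lambda>n. rod_diff k j (int n)) \<in> O(\<lambda>n. real n * rod_diff k (Suc j) (int n))"
proof -
  show "eventually (\<lambda>n. rod_diff k j (int n) \<ge> 0) sequentially"
  \<comment> \<open>These are the cases outside \<open>delta_bound\<close>: for bounded support the
    difference is eventually 0, and for \<open>k = 0\<close> it is \<open>p\<close> itself.\<close>
  proof (cases "eventually (\<lambda>n. p (int n) = 0) sequentially \<or> k = 0")
    case True
    then show ?thesis
    proof
      assume "eventually (\<lambda>n. p (int n) = 0) sequentially"
      then show ?thesis by eventually_elim (simp add: rod_diff_def)
    next
      assume "k = 0"
      then show ?thesis using j p_nonneg by (simp add: rod_diff_def asc_prod_def)
    qed
  next
    case False
    then have "(2 * real k - 2) * \<delta> < 1" using sum by (intro delta_bound) auto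
    from poly_eventually_pos[OF degree_rod_poly coeff_rod_poly_pos[OF this j]]
    show ?thesis
    proof eventually_elim
      case (elim n)
      have "rod_diff k j (int n) = asc_prod q (k - j) (int n) * p (int n) * poly (rod_poly k j) (real n)"
        by (simp add: rod_diff_def)
      then show ?case using elim asc_prod_p_nonneg[of "k - j" "int n"] by simp
    qed
  qed
  assume jk: "j < k"
  show "(\<lambda>n. rod_diff k j (int n)) \<in> O(\<lambda>n. real n * rod_diff k (Suc j) (int n))"
  proof (cases "eventually (\<lambda>n. p (int n) = 0) sequentially")
    case True
    then have "eventually (\<lambda>n. rod_diff k j (int n) = 0) sequentially"
      by eventually_elim (simp add: rod_diff_def)
    then show ?thesis by (intro bigoI[of _ 1]) (auto elim: eventually_mono)
  next
    case False
    then have b: "(2 * real k - 2) * \<delta> < 1" using sum jk by (intro delta_bound) auto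
    define r where "r = k - Suc j"
    have kj: "k - j = Suc r" using jk by (simp add: r_def)
    have "(\<lambda>n. q (int n + int r) * poly (rod_poly k j) (real n)) \<in> O(\<lambda>n. real n ^ 2 * real n ^ j)"
      by (intro landau_o.big_mult q_bigo poly_bigo degree_rod_poly)
    also have "(\<lambda>n. real n ^ 2 * real n ^ j) = (\<lambda>n. real n * real n ^ Suc j)"
      by (simp add: power2_eq_square mult.assoc)
    also have "(\<lambda>n. real n * real n ^ Suc j) \<in> O(\<lambda>n. real n * poly (rod_poly k (Suc j)) (real n))"
      using jk by (intro landau_o.big_mult landau_o.big_refl poly_bigomega degree_rod_poly
        coeff_rod_poly_pos[OF b]) simp
    finally have "(\<lambda>n. asc_prod q r (int n) * p (int n) * (q (int n + int r) * poly (rod_poly k j) (real n)))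
      \<in> O(\<lambda>n. asc_prod q r (int n) * p (int n) * (real n * poly (rod_poly k (Suc j)) (real n)))"
      by (rule landau_o.big_mult[OF landau_o.big_refl])
    then show ?thesis
      unfolding rod_diff_def kj r_def[symmetric] by (simp add: asc_prod_def mult_ac)
  qed
qed

text \<open>Nothing is known about the growth of g, so absolute summability is carried through the
  induction along with the value of the sum.\<close>

theorem rod_diff_parts:
  assumes sum: "summable (\<lambda>n. real n ^ (2 * k) * p (int n))"
    and g: "summable (\<lambda>n. \<bar>rod_diff k 0 (int n) * (fdiff ^^ k) g (int n)\<bar>)"
    and "j \<le> k"
  shows "summable (\<lambda>n. \<bar>rod_diff k j (int n) * (fdiff ^^ (k - j)) g (int n)\<bar>) \<and>
    (\<Sum>n. rod_diff k j (int n) * (fdiff ^^ (k - j)) g (int n)) =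
    (\<Sum>n. rod_diff k 0 (int n) * (fdiff ^^ k) g (int n))"
  using assms(3)
proof (induction j)
  case (Suc j)
  define h where "h = (fdiff ^^ (k - Suc j)) g"
  have "k - j = Suc (k - Suc j)" using Suc.prems by simp
  then have h: "(fdiff ^^ (k - j)) g = fdiff h" by (simp add: h_def)
  have j: "j < k" using Suc.prems by simp
  have IH: "summable (\<lambda>n. \<bar>rod_diff k j (int n) * fdiff h (int n)\<bar>)"
    "(\<Sum>n. rod_diff k j (int n) * fdiff h (int n)) =
      (\<Sum>n. rod_diff k 0 (int n) * (fdiff ^^ k) g (int n))"
    using Suc j by (simp_all add: h)
  have s: "summable (\<lambda>n. \<bar>rod_diff k (Suc j) (int n) * h (int n)\<bar>)"
    using Suc.prems j by (intro summable_by_parts[OF rod_diff_Suc _ _ IH(1)] rod_diff_eventually sum) auto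
  \<comment> \<open>The new summand itself controls the boundary term, because \<open>h\<close>
    cancels from the comparison.\<close>
  have "(\<lambda>n. rod_diff k j (int n) * h (int n)) \<in> O(\<lambda>n. real n * (rod_diff k (Suc j) (int n) * h (int n)))"
    unfolding mult.assoc[symmetric]
    using j by (intro landau_o.big_mult rod_diff_eventually sum) auto
  then have "(\<Sum>n. rod_diff k (Suc j) (int n) * h (int n)) = (\<Sum>n. rod_diff k j (int n) * fdiff h (int n))"
    using s by (intro suminf_by_parts[OF rod_diff_Suc[OF j] _ IH(1) s]) (auto simp: rod_diff_neg)
  then show ?case using s IH by (simp add: h_def)
qed (use g in simp)

end

section \<open>Truncated binomials and the inversion formula\<close>

definition tail_binomial :: "int \<Rightarrow> nat \<Rightarrow> int \<Rightarrow> real" where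
  "tail_binomial x m y = (if y > x then real (nat (y - x - 1) choose m) else 0)"

text \<open>Pascal's rule for y > x; at y = x the new value is \<open>0 choose Suc m = 0\<close>, so
  the truncation creates no jump.\<close>

lemma fdiff_tail_binomial_Suc: "fdiff (tail_binomial x (Suc m)) = tail_binomial x m"
proof
  fix y
  show "fdiff (tail_binomial x (Suc m)) y = tail_binomial x m y"
  proof (cases "y > x")
    case True
    then have "nat (y - x) = Suc (nat (y - x - 1))" by simp
    with True show ?thesis by (simp add: fdiff_def tail_binomial_def)
  qed (simp add: fdiff_def tail_binomial_def)
qed

lemma fdiff_tail_binomial_0: "fdiff (tail_binomial x 0) = (\<lambda>y. if y = x then 1 else 0)"
  by (auto simp: fdiff_def tail_binomial_def)

lemma tail_binomial_bigo: "x \<ge> 0 \<Longrightarrow> (\<lambda>n. tail_binomial x m (int n)) \<in> O(\<lambda>n. real n ^ m)"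
proof (rule bigoI[of _ 1], rule always_eventually, rule allI)
  fix n assume x: "x \<ge> 0"
  have "real (nat (int n - x - 1) choose m) \<le> real (nat (int n - x - 1) ^ m)"
    by (intro of_nat_mono) (metis binomial_le_pow binomial_eq_0 not_le zero_le)
  also have "\<dots> \<le> real n ^ m" using x by (auto intro!: power_mono)
  finally show "norm (tail_binomial x m (int n)) \<le> 1 * norm (real n ^ m)"
    by (simp add: tail_binomial_def)
qed

lemma falling_binomial: "real_of_int (falling (int n) m) = fact m * real (n choose m)"
proof -
  have "real_of_int (falling (int n) m) = (\<Prod>i<m. real n - real i)"
    by (simp add: falling_def)
  also have "\<dots> = fact m * (real n gchoose m)"
    by (simp add: gbinomial_prod_rev atLeast0LessThan)
  finally show ?thesis by (simp add: binomial_gbinomial)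
qed

context integrated_pearson
begin

theorem rod_diff_parts_tail_binomial:
  assumes k: "k \<ge> 1" and sum: "summable (\<lambda>n. real n ^ (2 * k - 1) * p (int n))" and x: "x \<ge> 0"
  shows "summable (\<lambda>n. \<bar>rod_diff k k (int n) * tail_binomial x (k - 1) (int n)\<bar>)"
    and "(\<Sum>n. rod_diff k k (int n) * tail_binomial x (k - 1) (int n)) = asc_prod q k x * p x"
proof -
  let ?u = "\<lambda>n. real n ^ (2 * k - 1) * p (int n)"
  let ?d = "\<lambda>y. if y = x then 1 else 0 :: real"
  have su: "summable (\<lambda>n. norm (?u n))" using sum by (simp add: p_nonneg abs_mult)
  have summ: "summable (\<lambda>n. \<bar>rod_diff k (Suc j) (int n) * tail_binomial x j (int n)\<bar>)" if "j < k" for j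
  proof -
    have "(\<lambda>n. rod_diff k (Suc j) (int n) * tail_binomial x j (int n)) \<in>
        O(\<lambda>n. real n ^ (2 * k - Suc j) * p (int n) * real n ^ j)"
      using that x by (intro landau_o.big_mult rod_diff_bigo tail_binomial_bigo) auto
    also have "2 * k - 1 = (2 * k - Suc j) + j" using that by simp
    then have "(\<lambda>n. real n ^ (2 * k - Suc j) * p (int n) * real n ^ j) = ?u"
      by (simp add: power_add mult_ac)
    finally show ?thesis by (intro summable_comparison_test_bigo[OF su]) simp
  qed
  have sd: "summable (\<lambda>n. \<bar>rod_diff k 0 (int n) * ?d (int n)\<bar>)"
    using x by (intro summable_finite[of "{nat x}"]) auto
  have main: "(\<Sum>n. rod_diff k (Suc j) (int n) * tail_binomial x j (int n)) =
      (\<Sum>n. rod_diff k 0 (int n) * ?d (int n))" if "j < k" for j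
    using that
  proof (induction j)
    case 0
    have "(\<lambda>n. rod_diff k 0 (int n) * tail_binomial x 0 (int n)) \<in>
        O(\<lambda>n. real n ^ (2 * k - 0) * p (int n) * real n ^ 0)"
      using x by (intro landau_o.big_mult rod_diff_bigo tail_binomial_bigo) auto
    also have "(\<lambda>n. real n ^ (2 * k - 0) * p (int n) * real n ^ 0) = (\<lambda>n. real n * ?u n)"
      using k by (simp add: power_eq_if[of _ "2 * k"] mult.assoc)
    finally show ?case
      using suminf_by_parts[OF rod_diff_Suc[OF 0] _ _ summ[OF 0] su] sd
      by (simp add: rod_diff_neg fdiff_tail_binomial_0)
  next
    case (Suc j)
    have "(\<lambda>n. rod_diff k (Suc j) (int n) * tail_binomial x (Suc j) (int n)) \<in>
        O(\<lambda>n. real n ^ (2 * k - Suc j) * p (int n) * real n ^ Suc j)"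
      using x Suc.prems by (intro landau_o.big_mult rod_diff_bigo tail_binomial_bigo) auto
    also have "2 * k - 1 = (2 * k - Suc j) + j" using Suc.prems by simp
    then have "(\<lambda>n. real n ^ (2 * k - Suc j) * p (int n) * real n ^ Suc j) = (\<lambda>n. real n * ?u n)"
      by (simp add: power_add mult_ac)
    finally have "(\<Sum>n. rod_diff k (Suc (Suc j)) (int n) * tail_binomial x (Suc j) (int n)) =
        (\<Sum>n. rod_diff k (Suc j) (int n) * tail_binomial x j (int n))"
      using suminf_by_parts[OF rod_diff_Suc[OF Suc.prems] _ _ summ[OF Suc.prems] su] summ[of j] Suc.prems
      by (simp add: rod_diff_neg fdiff_tail_binomial_Suc)
    with Suc show ?case by simp
  qed
  have "(\<Sum>n. rod_diff k 0 (int n) * ?d (int n)) = (\<Sum>n\<in>{nat x}. rod_diff k 0 (int n) * ?d (int n))"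
    using x by (intro suminf_finite) auto
  also have "\<dots> = asc_prod q k x * p x" using x by (simp add: rod_diff_0)
  finally show "summable (\<lambda>n. \<bar>rod_diff k k (int n) * tail_binomial x (k - 1) (int n)\<bar>)"
    "(\<Sum>n. rod_diff k k (int n) * tail_binomial x (k - 1) (int n)) = asc_prod q k x * p x"
    using summ[of "k - 1"] main[of "k - 1"] k by simp_all
qed

corollary inversion_formula:
  assumes k: "k \<ge> 1" and sum: "summable (\<lambda>n. real n ^ (2 * k - 1) * p (int n))"
  defines "t \<equiv> \<lambda>x n. real_of_int (falling (int n) (k - 1)) *
    rodrigues q p k (int x + 1 + int n) * p (int x + 1 + int n)"
  shows "summable (t x)" and "asc_prod q k (int x) * p (int x) = 1 / fact (k - 1) * (\<Sum>n. t x n)"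
proof -
  define f where "f n = rod_diff k k (int n) * tail_binomial (int x) (k - 1) (int n)" for n
  note f = rod_diff_parts_tail_binomial[OF k sum, of "int x", folded f_def]
  have sf: "summable f" using f(1) by (auto intro: summable_rabs_cancel)
  \<comment> \<open>The shift by \<open>Suc x\<close> puts y = n + x + 1, so y - x - 1 is n; the
    terms with y \<le> x vanish by truncation.\<close>
  have t: "t x n = fact (k - 1) * f (n + Suc x)" for n
  proof -
    have "int (n + Suc x) = int x + 1 + int n" by simp
    moreover have "nat (int x + 1 + int n - int x - 1) = n" by simp
    ultimately show ?thesis
      unfolding t_def f_def tail_binomial_def rodrigues_mult_p[symmetric] falling_binomial
      by (simp add: ac_simps)
  qed
  have sf': "summable (\<lambda>n. f (n + Suc x))" using sf by (rule summable_ignore_initial_segment)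
  then show "summable (t x)" unfolding t by (rule summable_mult)
  have "(\<Sum>n<Suc x. f n) = 0" by (intro sum.neutral) (auto simp: f_def tail_binomial_def)
  then have "suminf f = (\<Sum>n. f (n + Suc x))"
    using suminf_split_initial_segment[OF sf, of "Suc x"] by simp
  then show "asc_prod q k (int x) * p (int x) = 1 / fact (k - 1) * (\<Sum>n. t x n)"
    unfolding t suminf_mult[OF sf'] using f(2) by simp
qed

end

section \<open>From the random variable to the series identities\<close>

text \<open>The sign of q p is the point: up to the mean it is a sum of nonnegative terms, and past
  the mean it decreases to its limit, the expectation of \<mu> - X, which is 0.\<close>

lemma integrated_pearson_distribution:
  fixes X :: "'a \<Rightarrow> nat" and p q :: "int \<Rightarrow> real"
  assumes "prob_space M" and X: "X \<in> measurable M (count_space UNIV)"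
    and p: "\<And>x. p x = measure M {\<omega> \<in> space M. int (X \<omega>) = x}"
    and int: "integrable M (\<lambda>\<omega>. real (X \<omega>))"
    and \<mu>: "\<mu> = (\<integral>\<omega>. real (X \<omega>) \<partial>M)"
    and q: "\<And>x. q x = \<delta> * (real_of_int x)\<^sup>2 + \<beta> * real_of_int x + \<gamma>"
    and qp: "\<And>x::nat. (\<Sum>j=0..x. (\<mu> - real j) * p (int j)) = q (int x) * p (int x)"
  shows "integrated_pearson p q \<mu> \<delta> \<beta> \<gamma>"
proof
  interpret prob_space M by fact
  show p_nonneg: "p x \<ge> 0" for x by (simp add: p)
  show p_neg: "p x = 0" if "x < 0" for x
    using that by (auto simp: p intro!: measure_eq_0_null_sets arg_cong[of _ "{}" "measure M"])
  show "q x = \<delta> * (real_of_int x)\<^sup>2 + \<beta> * real_of_int x + \<gamma>" for x by (rule q)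
  have pn: "p (int n) = measure M {\<omega> \<in> space M. X \<omega> = n}" for n by (simp add: p)
  note iff = integrable_nat_valued_iff[OF finite_measure_axioms X, folded pn]
    and eq = integral_nat_valued[OF finite_measure_axioms X, folded pn]
  have i: "integrable M (\<lambda>\<omega>. \<mu> - real (X \<omega>))" using int by simp
  have "(\<lambda>n. (\<mu> - real n) * p (int n)) sums (\<integral>\<omega>. \<mu> - real (X \<omega>) \<partial>M)"
    unfolding eq[of "\<lambda>n. \<mu> - real n", OF i] using i iff[of "\<lambda>n. \<mu> - real n"]
    by (intro summable_sums) (auto intro: summable_rabs_cancel)
  also have "(\<integral>\<omega>. \<mu> - real (X \<omega>) \<partial>M) = 0"
    using int by (simp add: \<mu> prob_space)
  finally have lim: "(\<lambda>n. q (int n) * p (int n)) \<longlonglongrightarrow> 0"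
    by (simp add: sums_def_le qp[symmetric] atLeast0AtMost)
  have rec: "q x * p x - q (x - 1) * p (x - 1) = (\<mu> - real_of_int x) * p x" for x
  proof -
    \<comment> \<open>At \<open>x = 0\<close> the term at -1 vanishes by \<open>p_neg\<close>, so
      the relation is the hypothesis at 0.\<close>
    consider "x < 0" | "x = 0" | n where "x = int (Suc n)"
      by (metis not0_implies_Suc int_nat_eq linorder_not_less nat_0_iff of_nat_0)
    then show ?thesis
    proof cases
      case 3
      then show ?thesis using qp[of "Suc n"] qp[of n] by simp
    qed (use qp[of 0] in \<open>auto simp: p_neg\<close>)
  qed
  then show "q x * p x - q (x - 1) * p (x - 1) = (\<mu> - real_of_int x) * p x" for x .
  show "q x * p x \<ge> 0" for x
  proof (cases "x < 0")
    case False
    then obtain n where n: "x = int n" by (metis nonneg_int_cases not_less)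
    show ?thesis
    proof (cases "real n \<le> \<mu>")
      case True
      then have "(\<Sum>j=0..n. (\<mu> - real j) * p (int j)) \<ge> 0"
        by (intro sum_nonneg mult_nonneg_nonneg p_nonneg) auto
      then show ?thesis by (simp add: n qp)
    next
      case False
      have dec: "q (int m) * p (int m) \<le> q (int n) * p (int n)" if "n \<le> m" for m
        using that
      proof (induction m rule: dec_induct)
        case (step m)
        have "(\<mu> - real_of_int (int (Suc m))) * p (int (Suc m)) \<le> 0"
          using False step.hyps by (intro mult_nonpos_nonneg p_nonneg) auto
        then show ?case using rec[of "int (Suc m)"] step.IH by simp
      qed simp
      show ?thesis unfolding n
        by (rule tendsto_upperbound[OF lim]) (auto simp: eventually_sequentially intro: dec)
    qed
  qed (simp add: p_neg)
qed

theorem theorem2p2: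
  fixes M :: "'a measure" and X :: "'a \<Rightarrow> nat" and p q :: "int \<Rightarrow> real"
    and \<mu> \<delta> \<beta> \<gamma> :: real and J :: "int set" and k :: nat
  assumes "prob_space M"
    and "X \<in> measurable M (count_space UNIV)"
    and p: "\<And>x. p x = measure M {\<omega> \<in> space M. int (X \<omega>) = x}"
    and "integrable M (\<lambda>\<omega>. real (X \<omega>))"
    and \<mu>: "\<mu> = (\<integral>\<omega>. real (X \<omega>) \<partial>M)"
    and q: "\<And>x. q x = \<delta> * (real_of_int x)\<^sup>2 + \<beta> * real_of_int x + \<gamma>"
    and "\<And>x::nat. (\<Sum>j=0..x. (\<mu> - real j) * p (int j)) = q (int x) * p (int x)"
    and J: "J = {x. p x > 0}"
  shows
    "(\<forall>g :: int \<Rightarrow> real.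
        integrable M (\<lambda>\<omega>. real (X \<omega>) ^ (2 * k)) \<longrightarrow>
        integrable M (\<lambda>\<omega>. if int (X \<omega>) + int k \<in> J
          then asc_prod q k (int (X \<omega>)) * \<bar>(fdiff ^^ k) g (int (X \<omega>))\<bar> else 0) \<longrightarrow>
        integrable M (\<lambda>\<omega>. \<bar>rodrigues q p k (int (X \<omega>)) * g (int (X \<omega>))\<bar>) \<and>
        (\<integral>\<omega>. rodrigues q p k (int (X \<omega>)) * g (int (X \<omega>)) \<partial>M) =
        (\<integral>\<omega>. (if int (X \<omega>) + int k \<in> J
          then asc_prod q k (int (X \<omega>)) * (fdiff ^^ k) g (int (X \<omega>)) else 0) \<partial>M))
     \<and>
     (k \<ge> 1 \<longrightarrow> integrable M (\<lambda>\<omega>. real (X \<omega>) ^ (2 * k - 1)) \<longrightarrow>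
        (\<forall>x::nat.
          let t = (\<lambda>n. let y = int x + 1 + int n in
                real_of_int (falling (y - int x - 1) (k - 1)) * rodrigues q p k y * p y)
          in summable t \<and>
             asc_prod q k (int x) * p (int x) = 1 / fact (k - 1) * (\<Sum>n. t n)))"
proof -
  interpret prob_space M by fact
  interpret integrated_pearson p q \<mu> \<delta> \<beta> \<gamma>
    by (rule integrated_pearson_distribution) (fact assms)+
  have pn: "measure M {\<omega> \<in> space M. X \<omega> = n} = p (int n)" for n by (simp add: p)
  have integrable: "integrable M (\<lambda>\<omega>. f (X \<omega>)) \<longleftrightarrow> summable (\<lambda>n. \<bar>f n * p (int n)\<bar>)"
    for f :: "nat \<Rightarrow> real"
    using integrable_nat_valued_iff[OF finite_measure_axioms assms(2), of f] by (simp add: pn)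
  have integral: "(\<integral>\<omega>. f (X \<omega>) \<partial>M) = (\<Sum>n. f n * p (int n))"
    if "summable (\<lambda>n. \<bar>f n * p (int n)\<bar>)" for f :: "nat \<Rightarrow> real"
    using integral_nat_valued[OF finite_measure_axioms assms(2), of f] that
    unfolding integrable by (simp add: pn)
  have moment: "summable (\<lambda>n. real n ^ m * p (int n))" if "integrable M (\<lambda>\<omega>. real (X \<omega>) ^ m)" for m
    using that integrable[of "\<lambda>n. real n ^ m"] by (auto intro: summable_rabs_cancel)
  \<comment> \<open>If x + k lies outside J, then p x = 0 or q^[k](x) = 0, so after weighting by p
    the case distinction disappears.\<close>
  have guard: "(if x + int k \<in> J then asc_prod q k x * c else 0) * p x = rod_diff k 0 x * c" for x c
    using asc_prod_eq_0[of x k k] p_nonneg[of x] p_nonneg[of "x + int k"]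
    by (auto simp: J rod_diff_0 order_less_le)
  have "integrable M (\<lambda>\<omega>. \<bar>rodrigues q p k (int (X \<omega>)) * g (int (X \<omega>))\<bar>) \<and>
      (\<integral>\<omega>. rodrigues q p k (int (X \<omega>)) * g (int (X \<omega>)) \<partial>M) =
      (\<integral>\<omega>. (if int (X \<omega>) + int k \<in> J
        then asc_prod q k (int (X \<omega>)) * (fdiff ^^ k) g (int (X \<omega>)) else 0) \<partial>M)"
    if mom: "integrable M (\<lambda>\<omega>. real (X \<omega>) ^ (2 * k))"
      and g: "integrable M (\<lambda>\<omega>. if int (X \<omega>) + int k \<in> J
        then asc_prod q k (int (X \<omega>)) * \<bar>(fdiff ^^ k) g (int (X \<omega>))\<bar> else 0)" for g :: "int \<Rightarrow> real"
  proof -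
    have sum: "summable (\<lambda>n. \<bar>rod_diff k 0 (int n) * (fdiff ^^ k) g (int n)\<bar>)"
      using g integrable[of "\<lambda>n. if int n + int k \<in> J
        then asc_prod q k (int n) * \<bar>(fdiff ^^ k) g (int n)\<bar> else 0"]
      unfolding guard by (simp add: abs_mult)
    have R: "rodrigues q p k (int n) * g (int n) * p (int n) = rod_diff k k (int n) * g (int n)" for n
      by (simp add: rodrigues_mult_p[symmetric] mult_ac)
    \<comment> \<open>The case j = k, where no differences of g are left.\<close>
    note parts = rod_diff_parts[OF moment[OF mom] sum order_refl, simplified]
    have "integrable M (\<lambda>\<omega>. rodrigues q p k (int (X \<omega>)) * g (int (X \<omega>)))"
      using integrable[of "\<lambda>n. rodrigues q p k (int n) * g (int n)"] parts by (simp add: R)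
    moreover have "(\<integral>\<omega>. rodrigues q p k (int (X \<omega>)) * g (int (X \<omega>)) \<partial>M) =
        (\<Sum>n. rod_diff k k (int n) * g (int n))"
      using integral[of "\<lambda>n. rodrigues q p k (int n) * g (int n)"] parts by (simp add: R)
    moreover have "(\<integral>\<omega>. (if int (X \<omega>) + int k \<in> J
        then asc_prod q k (int (X \<omega>)) * (fdiff ^^ k) g (int (X \<omega>)) else 0) \<partial>M) =
        (\<Sum>n. rod_diff k 0 (int n) * (fdiff ^^ k) g (int n))"
      using integral[of "\<lambda>n. if int n + int k \<in> J
        then asc_prod q k (int n) * (fdiff ^^ k) g (int n) else 0"] sum
      unfolding guard by simp
    ultimately show ?thesis using parts by (simp add: integrable_abs)
  qed
  moreover have "let t = (\<lambda>n. let y = int x + 1 + int n in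
        real_of_int (falling (y - int x - 1) (k - 1)) * rodrigues q p k y * p y)
      in summable t \<and> asc_prod q k (int x) * p (int x) = 1 / fact (k - 1) * (\<Sum>n. t n)"
    if k: "k \<ge> 1" and mom: "integrable M (\<lambda>\<omega>. real (X \<omega>) ^ (2 * k - 1))" for x :: nat
  proof -
    have "int x + 1 + int n - int x - 1 = int n" for n by simp
    then show ?thesis
      using inversion_formula[OF k moment[OF mom], of x] unfolding Let_def by simp
  qed
  ultimately show ?thesis by blast
qed

end
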